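(* Let $M$ and $K$ be finite disjoint sets with $|M|=m$, and let $P$ be a poset on $K$. Then $$e(m,P)=|\mathcal{E}(M,P)|=|\mathcal{F}(M,P)|=|\mathcal{G}(M,P)|=|\mathcal{H}(M,P)|=|\mathcal{I}(M,P)|,$$ where $\mathcal{E}(M,P)$ is the set of partial orders $Q$ on $M\cup K$ whose set of minimal elements is exactly $M$ and which induce $P$ on $K$; $\mathcal{F}(M,P)=\{f:K\to\mathcal{P}_0(M)\mid x\le_P y\Rightarrow f(x)\subseteq f(y)\}$; $\mathcal{G}(M,P)=\{g:M\to\mathcal{U}(P)\mid \bigcup g[M]=K\}$; $\mathcal{H}(M,P)=\{h:\mathcal{D}(P)\to\mathcal{P}(M)\mid h \text{ preserves unions, and } h(D)=\emptyset\Rightarrow D=\emptyset\}$; $\mathcal{I}(M,P)=\{R\subseteq M\times K\mid R(\le_P)\subseteq R,\ MR=K\}$. Moreover, $e(m,P)$ is also the number of $T_0$ topologies on $M\cup K$ whose subspace topology on $K$ is $\mathcal{D}(P)$ and whose isolated points are exactly the points of $M$.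
   Context: $e(m,P)$ is defined as $|\mathcal{E}(M,P)|$ (it depends only on $m$). $\mathcal{P}(M)$ is the power set of $M$ and $\mathcal{P}_0(M)$ the set of nonempty subsets of $M$. $\mathcal{D}(P)$ and $\mathcal{U}(P)$ are the sets of downsets and upsets of $P$; $\mathcal{D}(P)$ is regarded as a topology on $K$. For $R\subseteq M\times K$, $R(\le_P)=\{(a,y)\mid \exists x: (a,x)\in R, x\le_P y\}$ and $MR=\{y\mid \exists a\in M:(a,y)\in R\}$. *)

theory Defs
  imports "HOL-Analysis.Abstract_Topological_Spaces" "HOL-Library.FuncSet"
begin

text \<open>
  A poset on \<^term>\<open>K\<close> is a relation \<^term>\<open>P\<close> with \<^term>\<open>partial_order_on K P\<close>;
  \<^term>\<open>(x, y) \<in> P\<close> stands for \<open>x \<le>\<^sub>P y\<close>.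
\<close>

definition downsets :: "'a set \<Rightarrow> 'a rel \<Rightarrow> 'a set set" where
  "downsets K P = {D. D \<subseteq> K \<and> (\<forall>x y. (x, y) \<in> P \<and> y \<in> D \<longrightarrow> x \<in> D)}"

definition upsets :: "'a set \<Rightarrow> 'a rel \<Rightarrow> 'a set set" where
  "upsets K P = {U. U \<subseteq> K \<and> (\<forall>x y. (x, y) \<in> P \<and> x \<in> U \<longrightarrow> y \<in> U)}"

definition minimal_elements :: "'a set \<Rightarrow> 'a rel \<Rightarrow> 'a set" where
  "minimal_elements A Q = {x \<in> A. \<forall>y \<in> A. (y, x) \<in> Q \<longrightarrow> y = x}"

definition order_extensions :: "'a set \<Rightarrow> 'a set \<Rightarrow> 'a rel \<Rightarrow> 'a rel set" where
  "order_extensions M K P =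
     {Q. partial_order_on (M \<union> K) Q \<and> minimal_elements (M \<union> K) Q = M \<and> Q \<inter> K \<times> K = P}"

text \<open>
  The number \<open>e(m,P)\<close> is attached to the natural number \<open>m\<close> and the poset, not to a particular
  \<open>m\<close>-element set.  It is defined by the canonical disjoint choice: the set \<open>{0, \<dots>, m - 1}\<close> in the
  left summand and a copy of the poset in the right summand of \<^typ>\<open>nat + 'a\<close>.
\<close>

definition extension_number :: "nat \<Rightarrow> 'a set \<Rightarrow> 'a rel \<Rightarrow> nat" where
  "extension_number m K P =
     card (order_extensions (Inl ` {..<m} :: (nat + 'a) set) (Inr ` K) (map_prod Inr Inr ` P))"

text \<open>
  Functions with a prescribed domain are taken in the extensional function space, so that they are
  determined by their values on that domain and can be counted.
\<close>

definition isotone_maps :: "'a set \<Rightarrow> 'a set \<Rightarrow> 'a rel \<Rightarrow> ('a \<Rightarrow> 'a set) set" where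
  "isotone_maps M K P =
     {f \<in> K \<rightarrow>\<^sub>E (Pow M - {{}}). \<forall>x y. (x, y) \<in> P \<longrightarrow> f x \<subseteq> f y}"

definition upset_covers :: "'a set \<Rightarrow> 'a set \<Rightarrow> 'a rel \<Rightarrow> ('a \<Rightarrow> 'a set) set" where
  "upset_covers M K P = {g \<in> M \<rightarrow>\<^sub>E upsets K P. \<Union> (g ` M) = K}"

text \<open>
  Preservation of unions includes the empty union, that is, \<open>h {} = {}\<close>.
\<close>

definition union_maps :: "'a set \<Rightarrow> 'a set \<Rightarrow> 'a rel \<Rightarrow> ('a set \<Rightarrow> 'a set) set" where
  "union_maps M K P =
     {h \<in> downsets K P \<rightarrow>\<^sub>E Pow M.
        (\<forall>\<S> \<subseteq> downsets K P. h (\<Union> \<S>) = \<Union> (h ` \<S>)) \<and>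
        (\<forall>D \<in> downsets K P. h D = {} \<longrightarrow> D = {})}"

definition ideal_relations :: "'a set \<Rightarrow> 'a set \<Rightarrow> 'a rel \<Rightarrow> 'a rel set" where
  "ideal_relations M K P = {R. R \<subseteq> M \<times> K \<and> R O P \<subseteq> R \<and> R `` M = K}"

definition isolated_points :: "'a topology \<Rightarrow> 'a set" where
  "isolated_points X = {x \<in> topspace X. openin X {x}}"

definition T0_topologies :: "'a set \<Rightarrow> 'a set \<Rightarrow> 'a rel \<Rightarrow> 'a topology set" where
  "T0_topologies M K P =
     {X. topspace X = M \<union> K \<and> t0_space X \<and>
         {U. openin (subtopology X K) U} = downsets K P \<and> isolated_points X = M}"

end

theory Submission
  imports Defs
begin

text \<open>
  Everything is encoded by the ideal relations.  A partial order in \<open>\<E>(M,P)\<close> is trivial on \<open>M\<close>, is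
  \<open>P\<close> on \<open>K\<close> and has nothing in \<open>K \<times> M\<close>, so it is determined by its part in \<open>M \<times> K\<close>; finiteness
  puts a minimal element below each point of \<open>K\<close>, which makes that part cover \<open>K\<close>.  The maps in \<open>\<F>\<close>
  and \<open>\<G>\<close> list the columns and the rows of such a relation, and a map in \<open>\<H>\<close> is determined by its
  values on principal downsets.  A finite topology is the family of downsets of its specialization
  order; it is \<open>T\<^sub>0\<close> iff that order is antisymmetric, and its isolated points are the minimal elements.
\<close>

section \<open>Ideal relations\<close>

lemma partial_order_onD:
  assumes "partial_order_on A r"
  shows "r \<subseteq> A \<times> A" "\<And>x. x \<in> A \<Longrightarrow> (x, x) \<in> r"
    "\<And>x y z. (x, y) \<in> r \<Longrightarrow> (y, z) \<in> r \<Longrightarrow> (x, z) \<in> r"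
    "\<And>x y. (x, y) \<in> r \<Longrightarrow> (y, x) \<in> r \<Longrightarrow> x = y"
  using assms unfolding partial_order_on_def preorder_on_def refl_on_def trans_def antisym_def
  by blast+

text \<open>Strong induction on the number of elements below \<open>x\<close>: if \<open>x\<close>
  is not minimal, some \<open>y\<close> lies strictly below it, and by antisymmetry the set below
  \<open>y\<close> omits \<open>x\<close>, so it is smaller.\<close>

lemma ex_minimal_below:
  assumes "finite A" "partial_order_on A Q" "x \<in> A"
  shows "\<exists>a \<in> minimal_elements A Q. (a, x) \<in> Q"
proof -
  note Q = partial_order_onD[OF assms(2)]
  let ?below = "\<lambda>x. Q\<inverse> `` {x}"
  have fin: "finite (?below y)" for y
    using Q(1) assms(1) by (auto intro: finite_subset)
  show ?thesis
    using assms(3)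
  proof (induction "card (?below x)" arbitrary: x rule: less_induct)
    case less
    show ?case
    proof (cases "x \<in> minimal_elements A Q")
      case True
      then show ?thesis
        using Q(2) less.prems by blast
    next
      case False
      then obtain y where y: "y \<in> A" "(y, x) \<in> Q" "y \<noteq> x"
        using less.prems by (auto simp: minimal_elements_def)
      then have "?below y \<subset> ?below x"
        using Q(2)[OF less.prems] Q(3,4) by blast
      then have "card (?below y) < card (?below x)"
        using fin by (rule psubset_card_mono[rotated])
      then show ?thesis
        using less.hyps[OF _ y(1)] Q(3) y(2) by blast
    qed
  qed
qed

text \<open>The order is rebuilt from \<open>R\<close> by adding \<open>P\<close> and the diagonal
  of \<open>M\<close>. The only new case of transitivity, a step of \<open>R\<close> followed by one
  of \<open>P\<close>, is the ideal condition; the covering condition is what keeps points of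
  \<open>K\<close> from being minimal.\<close>

lemma bij_betw_order_extensions_ideal_relations:
  assumes "finite M" "finite K" "M \<inter> K = {}" "partial_order_on K P"
  shows "bij_betw (\<lambda>Q. Q \<inter> M \<times> K) (order_extensions M K P) (ideal_relations M K P)"
proof (rule bij_betw_byWitness[where f' = "\<lambda>R. R \<union> P \<union> Id_on M"])
  note P = partial_order_onD[OF assms(4)]
  have ext: "partial_order_on (M \<union> K) Q" "minimal_elements (M \<union> K) Q = M" "Q \<inter> K \<times> K = P"
    if "Q \<in> order_extensions M K P" for Q
    using that by (auto simp: order_extensions_def)
  \<comment> \<open>This excludes pairs in \<open>K \<times> M\<close> and reduces the part on
    \<open>M \<times> M\<close> to the diagonal.\<close>
  have below_M: "y = x" if "Q \<in> order_extensions M K P" "(y, x) \<in> Q" "x \<in> M" for Q x y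
  proof -
    have "x \<in> minimal_elements (M \<union> K) Q" "y \<in> M \<union> K"
      using ext[OF that(1)] that partial_order_onD(1)[OF ext(1)[OF that(1)]] by auto
    then show ?thesis
      using that(2) by (auto simp: minimal_elements_def)
  qed
  show "\<forall>Q \<in> order_extensions M K P. Q \<inter> M \<times> K \<union> P \<union> Id_on M = Q"
  proof
    fix Q assume Q: "Q \<in> order_extensions M K P"
    note pQ = partial_order_onD[OF ext(1)[OF Q]]
    show "Q \<inter> M \<times> K \<union> P \<union> Id_on M = Q"
    proof (rule set_eqI, clarify)
      fix x y
      show "(x, y) \<in> Q \<inter> M \<times> K \<union> P \<union> Id_on M \<longleftrightarrow> (x, y) \<in> Q"
        using pQ(1) pQ(2)[of x] ext(3)[OF Q] below_M[OF Q, of x y] by auto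
    qed
  qed
  show "\<forall>R \<in> ideal_relations M K P. (R \<union> P \<union> Id_on M) \<inter> M \<times> K = R"
    using assms(3) P(1) by (auto simp: ideal_relations_def)
  show "(\<lambda>Q. Q \<inter> M \<times> K) ` order_extensions M K P \<subseteq> ideal_relations M K P"
  proof (rule image_subsetI)
    fix Q assume Q: "Q \<in> order_extensions M K P"
    note pQ = partial_order_onD[OF ext(1)[OF Q]]
    \<comment> \<open>Covering is where finiteness enters: the minimal element found below
      \<open>x\<close> belongs to \<open>M\<close>.\<close>
    have "x \<in> (Q \<inter> M \<times> K) `` M" if "x \<in> K" for x
      using ex_minimal_below[OF _ ext(1)[OF Q], of x] that assms(1,2) ext(2)[OF Q] by auto
    moreover have "(Q \<inter> M \<times> K) O P \<subseteq> Q \<inter> M \<times> K"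
      using pQ(3) ext(3)[OF Q] by blast
    ultimately show "Q \<inter> M \<times> K \<in> ideal_relations M K P"
      by (auto simp: ideal_relations_def)
  qed
  show "(\<lambda>R. R \<union> P \<union> Id_on M) ` ideal_relations M K P \<subseteq> order_extensions M K P"
  proof (rule image_subsetI)
    fix R assume "R \<in> ideal_relations M K P"
    then have R: "R \<subseteq> M \<times> K" "R O P \<subseteq> R" "R `` M = K"
      by (auto simp: ideal_relations_def)
    let ?Q = "R \<union> P \<union> Id_on M"
    have "?Q \<subseteq> (M \<union> K) \<times> (M \<union> K)"
      using R(1) P(1) by auto
    moreover have "refl_on (M \<union> K) ?Q"
      using P(2) by (auto simp: refl_on_def)
    moreover have "trans ?Q"
    proof (rule transI)
      fix x y z assume "(x, y) \<in> ?Q" "(y, z) \<in> ?Q"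
      then show "(x, z) \<in> ?Q"
        using R(1,2) P(1,3) assms(3) by blast
    qed
    moreover have "antisym ?Q"
    proof (rule antisymI)
      fix x y assume "(x, y) \<in> ?Q" "(y, x) \<in> ?Q"
      then show "x = y"
        using R(1) P(1,4) assms(3) by blast
    qed
    moreover have "minimal_elements (M \<union> K) ?Q = M"
    proof
      show "minimal_elements (M \<union> K) ?Q \<subseteq> M"
        using R(1,3) assms(3) by (auto simp: minimal_elements_def)
      show "M \<subseteq> minimal_elements (M \<union> K) ?Q"
        using R(1) P(1) assms(3) by (auto simp: minimal_elements_def)
    qed
    moreover have "?Q \<inter> K \<times> K = P"
      using R(1) P(1) assms(3) by auto
    ultimately show "?Q \<in> order_extensions M K P"
      by (auto simp: order_extensions_def partial_order_on_def preorder_on_def)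
  qed
qed

text \<open>The value \<open>f x\<close> is the column of \<open>R\<close> at \<open>x\<close>.
  Closure of \<open>R\<close> under \<open>P\<close> says that columns grow along \<open>P\<close>,
  and covering says that no column is empty.\<close>

lemma bij_betw_isotone_maps_ideal_relations:
  assumes "partial_order_on K P"
  shows "bij_betw (\<lambda>f. {(a, x). x \<in> K \<and> a \<in> f x}) (isotone_maps M K P) (ideal_relations M K P)"
proof (rule bij_betw_byWitness[where f' = "\<lambda>R. \<lambda>x\<in>K. R\<inverse> `` {x}"])
  note P = partial_order_onD[OF assms]
  show "\<forall>f \<in> isotone_maps M K P. (\<lambda>x\<in>K. {(a, x). x \<in> K \<and> a \<in> f x}\<inverse> `` {x}) = f"
    by (auto simp: isotone_maps_def PiE_def extensional_def fun_eq_iff)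
  show "\<forall>R \<in> ideal_relations M K P. {(a, x). x \<in> K \<and> a \<in> (\<lambda>x\<in>K. R\<inverse> `` {x}) x} = R"
    by (auto simp: ideal_relations_def)
  show "(\<lambda>f. {(a, x). x \<in> K \<and> a \<in> f x}) ` isotone_maps M K P \<subseteq> ideal_relations M K P"
  proof (rule image_subsetI)
    fix f assume f: "f \<in> isotone_maps M K P"
    then have "f x \<subseteq> M \<and> f x \<noteq> {}" if "x \<in> K" for x
      using that by (auto simp: isotone_maps_def PiE_def Pi_def)
    then show "{(a, x). x \<in> K \<and> a \<in> f x} \<in> ideal_relations M K P"
      using f P(1) unfolding ideal_relations_def isotone_maps_def by blast
  qed
  show "(\<lambda>R. \<lambda>x\<in>K. R\<inverse> `` {x}) ` ideal_relations M K P \<subseteq> isotone_maps M K P"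
  proof (rule image_subsetI)
    fix R assume "R \<in> ideal_relations M K P"
    then have R: "R \<subseteq> M \<times> K" "R O P \<subseteq> R" "R `` M = K"
      by (auto simp: ideal_relations_def)
    have "R\<inverse> `` {x} \<in> Pow M - {{}}" if "x \<in> K" for x
      using R(1,3) that by blast
    moreover have "R\<inverse> `` {x} \<subseteq> R\<inverse> `` {y}" if "(x, y) \<in> P" for x y
      using R(2) that by blast
    moreover have "x \<in> K" "y \<in> K" if "(x, y) \<in> P" for x y
      using P(1) that by auto
    ultimately show "(\<lambda>x\<in>K. R\<inverse> `` {x}) \<in> isotone_maps M K P"
      by (simp add: isotone_maps_def)
  qed
qed

text \<open>The value \<open>g a\<close> is the row of \<open>R\<close> at \<open>a\<close>. Closure
  of \<open>R\<close> under \<open>P\<close> says that every row is an upset, and covering says that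
  the rows have union \<open>K\<close>.\<close>

lemma bij_betw_upset_covers_ideal_relations:
  assumes "partial_order_on K P"
  shows "bij_betw (\<lambda>g. SIGMA a:M. g a) (upset_covers M K P) (ideal_relations M K P)"
proof (rule bij_betw_byWitness[where f' = "\<lambda>R. \<lambda>a\<in>M. R `` {a}"])
  note P = partial_order_onD[OF assms]
  show "\<forall>g \<in> upset_covers M K P. (\<lambda>a\<in>M. (SIGMA a:M. g a) `` {a}) = g"
    by (auto simp: upset_covers_def PiE_def extensional_def fun_eq_iff)
  show "\<forall>R \<in> ideal_relations M K P. (SIGMA a:M. (\<lambda>a\<in>M. R `` {a}) a) = R"
    by (auto simp: ideal_relations_def)
  show "(\<lambda>g. SIGMA a:M. g a) ` upset_covers M K P \<subseteq> ideal_relations M K P"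
  proof (rule image_subsetI)
    fix g assume "g \<in> upset_covers M K P"
    then have g: "\<And>a. a \<in> M \<Longrightarrow> g a \<in> upsets K P" and cover: "\<Union> (g ` M) = K"
      by (auto simp: upset_covers_def)
    have "(SIGMA a:M. g a) O P \<subseteq> (SIGMA a:M. g a)"
      using g by (auto simp: upsets_def)
    then show "(SIGMA a:M. g a) \<in> ideal_relations M K P"
      using cover by (auto simp: ideal_relations_def)
  qed
  show "(\<lambda>R. \<lambda>a\<in>M. R `` {a}) ` ideal_relations M K P \<subseteq> upset_covers M K P"
  proof (rule image_subsetI)
    fix R assume "R \<in> ideal_relations M K P"
    then have R: "R \<subseteq> M \<times> K" "R O P \<subseteq> R" "R `` M = K"
      by (auto simp: ideal_relations_def)
    have "R `` {a} \<in> upsets K P" for a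
      using R(1,2) unfolding upsets_def by blast
    then show "(\<lambda>a\<in>M. R `` {a}) \<in> upset_covers M K P"
      using R(3) by (auto simp: upset_covers_def)
  qed
qed

section \<open>Union-preserving maps on the lattice of downsets\<close>

lemma principal_downset:
  assumes "partial_order_on K P" "y \<in> K"
  shows "P\<inverse> `` {y} \<in> downsets K P"
  using partial_order_onD[OF assms(1)] by (auto simp: downsets_def)

text \<open>The principal downsets generate all downsets under unions, so \<open>h\<close> can be
  prescribed on them alone; its extension to a downset \<open>D\<close> is the preimage of
  \<open>D\<close> under \<open>R\<close>.\<close>

lemma bij_betw_union_maps_ideal_relations:
  assumes "partial_order_on K P"
  shows "bij_betw (\<lambda>h. {(a, y). y \<in> K \<and> a \<in> h (P\<inverse> `` {y})})
    (union_maps M K P) (ideal_relations M K P)"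
proof (rule bij_betw_byWitness[where f' = "\<lambda>R. \<lambda>D\<in>downsets K P. R\<inverse> `` D"])
  note P = partial_order_onD[OF assms]
  note principal = principal_downset[OF assms]
  \<comment> \<open>By reflexivity \<open>D\<close> is the union of the principal downsets of its
    points, and \<open>h\<close> preserves that union.\<close>
  have decomp: "h D = (\<Union>y\<in>D. h (P\<inverse> `` {y}))"
    if h: "h \<in> union_maps M K P" and D: "D \<in> downsets K P" for h D
  proof -
    let ?S = "(\<lambda>y. P\<inverse> `` {y}) ` D"
    have "?S \<subseteq> downsets K P"
      using D principal by (auto simp: downsets_def)
    then have "h (\<Union> ?S) = \<Union> (h ` ?S)"
      using h by (simp add: union_maps_def)
    moreover have "\<Union> ?S = D"
      using D P(2) by (auto simp: downsets_def)
    ultimately show ?thesis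
      by simp
  qed
  show "\<forall>h \<in> union_maps M K P.
      (\<lambda>D\<in>downsets K P. {(a, y). y \<in> K \<and> a \<in> h (P\<inverse> `` {y})}\<inverse> `` D) = h"
  proof (intro ballI ext)
    fix h D assume h: "h \<in> union_maps M K P"
    show "(\<lambda>D\<in>downsets K P. {(a, y). y \<in> K \<and> a \<in> h (P\<inverse> `` {y})}\<inverse> `` D) D = h D"
    proof (cases "D \<in> downsets K P")
      case True
      then have "D \<subseteq> K"
        by (simp add: downsets_def)
      then show ?thesis
        using True decomp[OF h True] by auto
    next
      case False
      then show ?thesis
        using h by (auto simp: union_maps_def PiE_def extensional_def)
    qed
  qed
  show "\<forall>R \<in> ideal_relations M K P.
      {(a, y). y \<in> K \<and> a \<in> (\<lambda>D\<in>downsets K P. R\<inverse> `` D) (P\<inverse> `` {y})} = R"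
  proof
    fix R assume "R \<in> ideal_relations M K P"
    then have "R \<subseteq> M \<times> K" "R O P \<subseteq> R"
      by (auto simp: ideal_relations_def)
    then show "{(a, y). y \<in> K \<and> a \<in> (\<lambda>D\<in>downsets K P. R\<inverse> `` D) (P\<inverse> `` {y})} = R"
      using principal P(2) by auto blast
  qed
  show "(\<lambda>h. {(a, y). y \<in> K \<and> a \<in> h (P\<inverse> `` {y})}) ` union_maps M K P \<subseteq> ideal_relations M K P"
  proof (rule image_subsetI)
    fix h assume h: "h \<in> union_maps M K P"
    let ?R = "{(a, y). y \<in> K \<and> a \<in> h (P\<inverse> `` {y})}"
    \<comment> \<open>The value is nonempty because the principal downset of \<open>y\<close>
      contains \<open>y\<close>.\<close>
    have M: "h (P\<inverse> `` {y}) \<subseteq> M" "h (P\<inverse> `` {y}) \<noteq> {}" if "y \<in> K" for y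
      using h principal[OF that] P(2)[OF that] by (auto simp: union_maps_def PiE_def Pi_def)
    have "?R O P \<subseteq> ?R"
    proof clarify
      fix a x y assume xy: "(x, y) \<in> P" and a: "a \<in> h (P\<inverse> `` {x})"
      then have "y \<in> K"
        using P(1) by auto
      \<comment> \<open>Decomposing the principal downset of \<open>y\<close> exhibits
        \<open>h\<close> at \<open>x\<close> as one of the sets in the union, since \<open>x\<close>
        is below \<open>y\<close>.\<close>
      then show "y \<in> K \<and> a \<in> h (P\<inverse> `` {y})"
        using decomp[OF h principal[OF \<open>y \<in> K\<close>]] xy a by auto
    qed
    then show "?R \<in> ideal_relations M K P"
      using M unfolding ideal_relations_def by blast
  qed
  show "(\<lambda>R. \<lambda>D\<in>downsets K P. R\<inverse> `` D) ` ideal_relations M K P \<subseteq> union_maps M K P"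
  proof (rule image_subsetI)
    fix R assume "R \<in> ideal_relations M K P"
    then have R: "R \<subseteq> M \<times> K" "R `` M = K"
      by (auto simp: ideal_relations_def)
    have Union: "\<Union> \<S> \<in> downsets K P" if "\<S> \<subseteq> downsets K P" for \<S>
      using that unfolding downsets_def by blast
    have "R\<inverse> `` D \<subseteq> M" for D
      using R(1) by auto
    moreover have "D = {}" if "D \<in> downsets K P" "R\<inverse> `` D = {}" for D
      using that R(2) unfolding downsets_def by blast
    moreover have "(\<lambda>D\<in>downsets K P. R\<inverse> `` D) (\<Union> \<S>)
        = \<Union> ((\<lambda>D\<in>downsets K P. R\<inverse> `` D) ` \<S>)" if "\<S> \<subseteq> downsets K P" for \<S>
    proof -
      \<comment> \<open>Once the restriction to downsets is removed, what remains is that preimages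
        commute with unions.\<close>
      have "(\<lambda>D\<in>downsets K P. R\<inverse> `` D) ` \<S> = (\<lambda>D. R\<inverse> `` D) ` \<S>"
        using that by (intro image_cong) auto
      then show ?thesis
        using Union[OF that] by auto
    qed
    ultimately show "(\<lambda>D\<in>downsets K P. R\<inverse> `` D) \<in> union_maps M K P"
      by (auto simp: union_maps_def)
  qed
qed

section \<open>Independence of the ground set\<close>

text \<open>Composition is the delicate point: a chain through \<open>b x = b y\<close> lifts to a
  chain in the original relations only because injectivity gives \<open>x = y\<close>.\<close>

lemma map_prod_image_ideal_relations:
  assumes "inj_on b (M \<union> K)" "P \<subseteq> K \<times> K" "R \<in> ideal_relations M K P"
  shows "map_prod b b ` R \<in> ideal_relations (b ` M) (b ` K) (map_prod b b ` P)"
proof -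
  have R: "R \<subseteq> M \<times> K" "R O P \<subseteq> R" "R `` M = K"
    using assms(3) by (auto simp: ideal_relations_def)
  have "map_prod b b ` R O map_prod b b ` P \<subseteq> map_prod b b ` R"
  proof (clarsimp)
    fix a x y z assume "(a, x) \<in> R" "(y, z) \<in> P" "b x = b y"
    moreover from this have "x = y"
      using assms(1,2) R(1) by (auto dest: inj_onD)
    ultimately show "(b a, b z) \<in> map_prod b b ` R"
      using R(2) by force
  qed
  moreover have "(map_prod b b ` R) `` (b ` M) = b ` K"
    using R(1,3) by (force simp: Image_def)
  ultimately show ?thesis
    using R(1) by (auto simp: ideal_relations_def)
qed

lemma map_prod_image_inverse:
  assumes "\<And>x. x \<in> A \<Longrightarrow> c (b x) = x" "r \<subseteq> A \<times> A"
  shows "map_prod c c ` map_prod b b ` r = r"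
proof -
  have "map_prod c c (map_prod b b p) = p" if "p \<in> r" for p
    using assms that by auto
  then show ?thesis
    by (simp add: image_image)
qed

text \<open>Renaming along \<open>b\<close> and along its inverse on \<open>M \<union> K\<close> are
  mutually inverse; the previous transport lemma is applied once in each direction.\<close>

lemma card_ideal_relations_image:
  assumes "inj_on b (M \<union> K)" "P \<subseteq> K \<times> K"
  shows "card (ideal_relations (b ` M) (b ` K) (map_prod b b ` P)) = card (ideal_relations M K P)"
proof -
  let ?A = "M \<union> K" and ?c = "inv_into (M \<union> K) b"
  have cb: "?c (b x) = x" if "x \<in> ?A" for x
    using assms(1) that by simp
  have bc: "b (?c y) = y" if "y \<in> b ` ?A" for y
    using that by (rule f_inv_into_f)
  have inverse_image: "map_prod ?c ?c ` R \<in> ideal_relations M K P"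
    if "R \<in> ideal_relations (b ` M) (b ` K) (map_prod b b ` P)" for R
  proof -
    have "?c ` b ` M = M" "?c ` b ` K = K"
      using cb by (auto simp: image_image)
    moreover have "map_prod ?c ?c ` map_prod b b ` P = P"
      using assms(2) by (intro map_prod_image_inverse[of ?A]) (auto simp: cb)
    moreover have "inj_on ?c (b ` M \<union> b ` K)"
      by (simp add: inj_on_inv_into flip: image_Un)
    moreover have "map_prod b b ` P \<subseteq> b ` K \<times> b ` K"
      using assms(2) by auto
    ultimately show ?thesis
      using map_prod_image_ideal_relations[OF _ _ that, of ?c] by simp
  qed
  have "bij_betw (image (map_prod b b)) (ideal_relations M K P)
      (ideal_relations (b ` M) (b ` K) (map_prod b b ` P))"
  proof (rule bij_betw_byWitness[where f' = "image (map_prod ?c ?c)"])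
    show "\<forall>R \<in> ideal_relations M K P. map_prod ?c ?c ` map_prod b b ` R = R"
      by (intro ballI map_prod_image_inverse[of ?A] cb) (auto simp: ideal_relations_def)
    show "\<forall>R \<in> ideal_relations (b ` M) (b ` K) (map_prod b b ` P).
        map_prod b b ` map_prod ?c ?c ` R = R"
    proof
      fix R assume "R \<in> ideal_relations (b ` M) (b ` K) (map_prod b b ` P)"
      then have "R \<subseteq> b ` ?A \<times> b ` ?A"
        by (auto simp: ideal_relations_def)
      then show "map_prod b b ` map_prod ?c ?c ` R = R"
        by (intro map_prod_image_inverse[of "b ` ?A"] bc)
    qed
  qed (use inverse_image map_prod_image_ideal_relations[OF assms] in auto)
  then show ?thesis
    by (simp add: bij_betw_same_card)
qed

lemma partial_order_on_image:
  assumes "inj_on b A" "partial_order_on A r"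
  shows "partial_order_on (b ` A) (map_prod b b ` r)"
proof -
  note r = partial_order_onD[OF assms(2)]
  have inj: "x = y" if "b x = b y" "x \<in> A" "y \<in> A" for x y
    using assms(1) that by (auto dest: inj_onD)
  have "trans (map_prod b b ` r)"
  proof (rule transI, clarsimp)
    fix x y y' z assume *: "(x, y) \<in> r" "(y', z) \<in> r" "b y = b y'"
    then have "y = y'"
      using inj r(1) by blast
    then show "(b x, b z) \<in> map_prod b b ` r"
      using * r(3) by (metis map_prod_imageI)
  qed
  moreover have "antisym (map_prod b b ` r)"
  proof (rule antisymI, clarsimp)
    fix x y x' y' assume *: "(x, y) \<in> r" "(y', x') \<in> r" "b y = b y'" "b x = b x'"
    then have "y = y'" "x = x'"
      using inj r(1) by blast+
    then show "b x' = b y'"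
      using * r(4) by blast
  qed
  ultimately show ?thesis
    using r(1,2) by (auto simp: partial_order_on_def preorder_on_def refl_on_def)
qed

text \<open>The canonical ground set lives in the type \<open>nat + 'a\<close>. Passing to ideal
  relations before renaming avoids transporting minimal elements and whole orders along the
  bijection.\<close>

lemma extension_number_eq_card_ideal_relations:
  assumes "finite M" "finite K" "M \<inter> K = {}" "partial_order_on K P"
  shows "extension_number (card M) K P = card (ideal_relations M K P)"
proof -
  obtain e where e: "bij_betw e M {..<card M}"
    using ex_bij_betw_finite_nat[OF assms(1)] by (auto simp: atLeast0LessThan)
  \<comment> \<open>Points of \<open>M\<close> become their numbers in the left summand and all
    others are tagged on the right, so \<open>b\<close> carries the given data exactly onto the
    canonical data.\<close>
  define b where "b = (\<lambda>x. if x \<in> M then Inl (e x) else Inr x)"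
  note P = partial_order_onD[OF assms(4)]
  have notM: "x \<notin> M" if "x \<in> K" for x
    using that assms(3) by auto
  have inj: "inj_on b (M \<union> K)"
    using e by (auto simp: b_def inj_on_def bij_betw_def)
  have "b ` M = Inl ` e ` M"
    by (auto simp: b_def)
  then have bM: "b ` M = Inl ` {..<card M}"
    using e by (simp add: bij_betw_def)
  have bK: "b ` K = Inr ` K"
    using notM by (force simp: b_def)
  have bP: "map_prod b b ` P = map_prod Inr Inr ` P"
    using P(1) notM by (intro image_cong) (auto simp: b_def)
  have "extension_number (card M) K P
      = card (order_extensions (b ` M) (b ` K) (map_prod b b ` P))"
    by (simp add: extension_number_def bM bK bP)
  also have "\<dots> = card (ideal_relations (b ` M) (b ` K) (map_prod b b ` P))"
  proof (rule bij_betw_same_card[OF bij_betw_order_extensions_ideal_relations])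
    show "b ` M \<inter> b ` K = {}"
      by (auto simp: bM bK)
    show "partial_order_on (b ` K) (map_prod b b ` P)"
      using inj assms(4) by (intro partial_order_on_image) (auto simp: inj_on_Un)
  qed (use assms in auto)
  also have "\<dots> = card (ideal_relations M K P)"
    using inj P(1) by (rule card_ideal_relations_image)
  finally show ?thesis .
qed

section \<open>Finite topologies and their specialization orders\<close>

text \<open>Downsets rather than upsets are taken as open sets, so that minimal elements become
  isolated points.\<close>

definition alexandrov_topology :: "'a set \<Rightarrow> 'a rel \<Rightarrow> 'a topology" where
  "alexandrov_topology A Q = topology (\<lambda>U. U \<in> downsets A Q)"

text \<open>A pair \<open>(x, y)\<close> says that \<open>y\<close> lies in the closure of
  \<open>{x}\<close>; with this orientation open sets are downsets.\<close>

definition specialization :: "'a topology \<Rightarrow> 'a rel" where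
  "specialization X =
     {(x, y). x \<in> topspace X \<and> y \<in> topspace X \<and> (\<forall>U. openin X U \<and> y \<in> U \<longrightarrow> x \<in> U)}"

lemma openin_alexandrov_topology [simp]:
  "openin (alexandrov_topology A Q) U \<longleftrightarrow> U \<in> downsets A Q"
proof -
  have "istopology (\<lambda>U. U \<in> downsets A Q)"
    unfolding istopology_def downsets_def by blast
  then show ?thesis
    by (simp add: alexandrov_topology_def)
qed

lemma topspace_alexandrov_topology:
  assumes "Q \<subseteq> A \<times> A"
  shows "topspace (alexandrov_topology A Q) = A"
  using assms by (auto simp: topspace_def downsets_def)

text \<open>The principal downset of \<open>y\<close> is an open set containing \<open>y\<close>,
  and testing against it alone recovers the points below \<open>y\<close>.\<close>

lemma specialization_alexandrov_topology:
  assumes "partial_order_on A Q"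
  shows "specialization (alexandrov_topology A Q) = Q"
proof -
  note Q = partial_order_onD[OF assms]
  have "(x, y) \<in> Q" if "y \<in> A" "\<forall>U. U \<in> downsets A Q \<and> y \<in> U \<longrightarrow> x \<in> U" for x y
    using that(2) principal_downset[OF assms that(1)] Q(2)[OF that(1)] by blast
  moreover have "x \<in> U" if "(x, y) \<in> Q" "U \<in> downsets A Q" "y \<in> U" for x y U
    using that by (auto simp: downsets_def)
  ultimately show ?thesis
    using Q(1) by (auto simp: specialization_def topspace_alexandrov_topology)
qed

text \<open>In a finite space every point has a smallest open neighbourhood, namely the set of
  points below it, so a downset is a neighbourhood of each of its points.\<close>

lemma openin_iff_downset_specialization:
  assumes "finite (topspace X)"
  shows "openin X U \<longleftrightarrow> U \<in> downsets (topspace X) (specialization X)"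
proof
  assume "openin X U"
  then show "U \<in> downsets (topspace X) (specialization X)"
    by (auto simp: downsets_def specialization_def dest: openin_subset)
next
  assume U: "U \<in> downsets (topspace X) (specialization X)"
  show "openin X U"
  proof (subst openin_subopen, intro ballI)
    fix y assume "y \<in> U"
    let ?N = "\<Inter> {V. openin X V \<and> y \<in> V}"
    have y: "y \<in> topspace X"
      using U \<open>y \<in> U\<close> by (auto simp: downsets_def)
    have "finite {V. openin X V \<and> y \<in> V}"
    proof (rule finite_subset)
      show "{V. openin X V \<and> y \<in> V} \<subseteq> Pow (topspace X)"
        by (auto dest: openin_subset)
    qed (use assms in simp)
    \<comment> \<open>The intersection is over a finite family, nonempty because \<open>y\<close>
      lies in the whole space.\<close>
    then have "openin X ?N"
      using y by (intro openin_Inter) auto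
    moreover have "?N \<subseteq> U"
    proof
      fix x assume "x \<in> ?N"
      then have "(x, y) \<in> specialization X"
        using y by (auto simp: specialization_def)
      then show "x \<in> U"
        using U \<open>y \<in> U\<close> by (auto simp: downsets_def)
    qed
    ultimately show "\<exists>T. openin X T \<and> y \<in> T \<and> T \<subseteq> U"
      by auto
  qed
qed

lemma alexandrov_topology_specialization:
  assumes "finite (topspace X)"
  shows "alexandrov_topology (topspace X) (specialization X) = X"
  by (simp add: topology_eq openin_iff_downset_specialization[OF assms])

text \<open>The specialization relation is always a preorder; two points are related both ways iff
  no open set separates them, so antisymmetry is the separation axiom.\<close>

lemma t0_space_iff_partial_order_specialization:
  "t0_space X \<longleftrightarrow> partial_order_on (topspace X) (specialization X)"
proof -
  have "specialization X \<subseteq> topspace X \<times> topspace X" "refl_on (topspace X) (specialization X)"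
    "trans (specialization X)"
    by (auto simp: specialization_def refl_on_def trans_def)
  moreover have "antisym (specialization X) \<longleftrightarrow> t0_space X"
  proof -
    define indist where "indist x y \<longleftrightarrow> (\<forall>U. openin X U \<longrightarrow> (x \<in> U \<longleftrightarrow> y \<in> U))" for x y
    have "(x, y) \<in> specialization X \<and> (y, x) \<in> specialization X \<longleftrightarrow>
        x \<in> topspace X \<and> y \<in> topspace X \<and> indist x y" for x y
      by (auto simp: specialization_def indist_def)
    moreover have "t0_space X \<longleftrightarrow>
        (\<forall>x \<in> topspace X. \<forall>y \<in> topspace X. x \<noteq> y \<longrightarrow> \<not> indist x y)"
      by (auto simp: t0_space_def indist_def)
    ultimately show ?thesis
      unfolding antisym_def by blast
  qed
  ultimately show ?thesis
    by (simp add: partial_order_on_def preorder_on_def)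
qed

lemma isolated_points_eq_minimal_elements:
  assumes "finite (topspace X)"
  shows "isolated_points X = minimal_elements (topspace X) (specialization X)"
proof -
  have "specialization X \<subseteq> topspace X \<times> topspace X"
    by (auto simp: specialization_def)
  then show ?thesis
    unfolding isolated_points_def minimal_elements_def openin_iff_downset_specialization[OF assms]
      downsets_def by blast
qed

lemma specialization_subtopology:
  assumes "S \<subseteq> topspace X"
  shows "specialization (subtopology X S) = specialization X \<inter> S \<times> S"
proof -
  have "topspace (subtopology X S) = S"
    using assms by auto
  moreover have "(\<forall>U. openin (subtopology X S) U \<and> y \<in> U \<longrightarrow> x \<in> U) \<longleftrightarrow>
      (\<forall>U. openin X U \<and> y \<in> U \<longrightarrow> x \<in> U)" if "x \<in> S" "y \<in> S" for x y
    using that by (auto simp: openin_subtopology)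
  ultimately show ?thesis
    using assms by (auto simp: specialization_def)
qed

text \<open>This turns the prescribed subspace topology into an equation between relations, since a
  partial order is recovered from its downsets.\<close>

lemma open_sets_eq_downsets_iff:
  assumes "finite (topspace X)" "partial_order_on (topspace X) P"
  shows "{U. openin X U} = downsets (topspace X) P \<longleftrightarrow> specialization X = P"
proof
  assume "{U. openin X U} = downsets (topspace X) P"
  then have "X = alexandrov_topology (topspace X) P"
    by (auto simp: topology_eq)
  then show "specialization X = P"
    using specialization_alexandrov_topology[OF assms(2)] by simp
qed (use openin_iff_downset_specialization[OF assms(1)] in auto)

lemma T0_topologies_eq:
  assumes "finite M" "finite K" "partial_order_on K P"
  shows "T0_topologies M K P =
    {X. topspace X = M \<union> K \<and> specialization X \<in> order_extensions M K P}"
proof -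
  have "{U. openin (subtopology X K) U} = downsets K P \<longleftrightarrow> specialization X \<inter> K \<times> K = P"
    if "topspace X = M \<union> K" for X
  proof -
    have "topspace (subtopology X K) = K"
      using that by auto
    then show ?thesis
      using open_sets_eq_downsets_iff[of "subtopology X K" P] assms that
      by (simp add: specialization_subtopology)
  qed
  moreover have "isolated_points X = minimal_elements (M \<union> K) (specialization X)"
    if "topspace X = M \<union> K" for X
    using isolated_points_eq_minimal_elements[of X] that assms(1,2) by simp
  moreover have "t0_space X \<longleftrightarrow> partial_order_on (M \<union> K) (specialization X)"
    if "topspace X = M \<union> K" for X
    using t0_space_iff_partial_order_specialization[of X] that by simp
  ultimately show ?thesis
    unfolding T0_topologies_def order_extensions_def mem_Collect_eq
    \<comment> \<open>The three equivalences hold only under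
      \<open>topspace X = M \<union> K\<close>; \<open>conj_cong\<close> supplies that conjunct
      while the others are rewritten.\<close>
    by (intro Collect_cong) (simp only: conj_ac cong: conj_cong)
qed

lemma bij_betw_T0_topologies_order_extensions:
  assumes "finite M" "finite K" "partial_order_on K P"
  shows "bij_betw specialization (T0_topologies M K P) (order_extensions M K P)"
proof (rule bij_betw_byWitness[where f' = "alexandrov_topology (M \<union> K)"])
  have po: "partial_order_on (M \<union> K) Q" if "Q \<in> order_extensions M K P" for Q
    using that by (simp add: order_extensions_def)
  show "\<forall>X \<in> T0_topologies M K P. alexandrov_topology (M \<union> K) (specialization X) = X"
  proof
    fix X assume "X \<in> T0_topologies M K P"
    then have "topspace X = M \<union> K"
      by (simp add: T0_topologies_def)
    then show "alexandrov_topology (M \<union> K) (specialization X) = X"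
      using alexandrov_topology_specialization[of X] assms(1,2) by simp
  qed
  show "\<forall>Q \<in> order_extensions M K P. specialization (alexandrov_topology (M \<union> K) Q) = Q"
    using po by (simp add: specialization_alexandrov_topology)
  then show "alexandrov_topology (M \<union> K) ` order_extensions M K P \<subseteq> T0_topologies M K P"
    using po by (auto simp: T0_topologies_eq[OF assms]
        topspace_alexandrov_topology[OF partial_order_onD(1)[OF po]])
  show "specialization ` T0_topologies M K P \<subseteq> order_extensions M K P"
    by (auto simp: T0_topologies_eq[OF assms])
qed

theorem theorem4p1:
  fixes M K :: "'a set" and P :: "'a rel" and m :: nat
  assumes "finite M" and "finite K" and "M \<inter> K = {}" and "card M = m"
    and "partial_order_on K P"
  shows "extension_number m K P = card (order_extensions M K P)
       \<and> card (order_extensions M K P) = card (isotone_maps M K P)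
       \<and> card (isotone_maps M K P) = card (upset_covers M K P)
       \<and> card (upset_covers M K P) = card (union_maps M K P)
       \<and> card (union_maps M K P) = card (ideal_relations M K P)
       \<and> extension_number m K P = card (T0_topologies M K P)"
  \<comment> \<open>All counts are compared with \<open>card (ideal_relations M K P)\<close>; the
    topologies reach it through \<open>order_extensions M K P\<close>.\<close>
  using extension_number_eq_card_ideal_relations[OF assms(1-3,5)] assms(4)
    bij_betw_same_card[OF bij_betw_order_extensions_ideal_relations[OF assms(1-3,5)]]
    bij_betw_same_card[OF bij_betw_isotone_maps_ideal_relations[OF assms(5), of M]]
    bij_betw_same_card[OF bij_betw_upset_covers_ideal_relations[OF assms(5), of M]]
    bij_betw_same_card[OF bij_betw_union_maps_ideal_relations[OF assms(5), of M]]
    bij_betw_same_card[OF bij_betw_T0_topologies_order_extensions[OF assms(1,2,5)]]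
  by simp

end
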